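(* Let $\mathcal{G}=(X,\mathcal{F},P)$ be a Maker-Breaker poset positional game where $P$ is made of pairwise disjoint chains and every element of $\mathcal{F}$ has size $1$, with Maker starting. Then Maker has a winning strategy if and only if at least one of the following holds: (i) some winning set consists of a minimal element of $P$; (ii) some winning set consists of a white vertex; (iii) $|X|$ is odd and there are two winning sets consisting of black vertices lying on different chains. In particular, the winner can be determined in linear time for such games.
   Context: A poset positional game is a triple $(X,\mathcal{F},P)$ with $X$ a finite board of vertices, $\mathcal{F}\subseteq 2^X$ the winning sets, and $P$ a partial order on $X$. Two players alternately claim an unclaimed vertex $v$ such that all vertices smaller than $v$ in $P$ are already claimed, until all vertices are claimed. In the Maker-Breaker convention, Maker wins if she claims all vertices of some winning set; otherwise Breaker wins. $P$ is made of pairwise disjoint chains $C_1,\dots,C_w$ (partitioning $X$, elements of distinct chains incomparable); the elements of $C_i$ are written $x_{i,1}>x_{i,2}>\dots>x_{i,\ell_i}$ (numbered from top to bottom). The vertex $x_{i,j}$ is colored white if $j$ has the same parity as $|X|$, and black otherwise. A winning set is called white (resp. black) if it consists of a single white (resp. black) vertex. *)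

theory Defs
  imports Main
begin

definition poset_game :: "'a set \<Rightarrow> 'a set set \<Rightarrow> ('a \<times> 'a) set \<Rightarrow> bool" where
  "poset_game X F P \<longleftrightarrow> finite X \<and> F \<subseteq> Pow X \<and> partial_order_on X P"
  \<comment> \<open>\<open>(u, v) \<in> P\<close> means that \<open>u\<close> is below or equal to \<open>v\<close>.\<close>

datatype player = Maker | Breaker

text \<open>A play is the list of the vertices claimed so far, in the order in which they were claimed.
  Maker starts, so the moves with an even index (counting from 0) are hers.\<close>

definition mover :: "nat \<Rightarrow> player" where
  "mover k = (if even k then Maker else Breaker)"

definition legal_play :: "'a set \<Rightarrow> ('a \<times> 'a) set \<Rightarrow> 'a list \<Rightarrow> bool" where
  "legal_play X P vs \<longleftrightarrow> distinct vs \<and> set vs \<subseteq> X \<and>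
     (\<forall>k<length vs. \<forall>u\<in>X. (u, vs ! k) \<in> P \<and> u \<noteq> vs ! k \<longrightarrow> u \<in> set (take k vs))"

definition claimed_by :: "player \<Rightarrow> 'a list \<Rightarrow> 'a set" where
  "claimed_by p vs = {vs ! k | k. k < length vs \<and> mover k = p}"

definition wins_play :: "'a set set \<Rightarrow> player \<Rightarrow> 'a list \<Rightarrow> bool" where
  "wins_play F p vs \<longleftrightarrow>
     (case p of
        Maker \<Rightarrow> \<exists>A\<in>F. A \<subseteq> claimed_by Maker vs
      | Breaker \<Rightarrow> \<not> (\<exists>A\<in>F. A \<subseteq> claimed_by Maker vs))"

definition follows :: "player \<Rightarrow> ('a list \<Rightarrow> 'a) \<Rightarrow> 'a list \<Rightarrow> bool" where
  "follows p \<sigma> vs \<longleftrightarrow> (\<forall>k<length vs. mover k = p \<longrightarrow> vs ! k = \<sigma> (take k vs))"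

text \<open>The first conjunct makes \<open>\<sigma>\<close> prescribe legal moves; without it a strategy
  prescribing illegal moves would win vacuously.\<close>

definition winning_strategy ::
  "'a set \<Rightarrow> 'a set set \<Rightarrow> ('a \<times> 'a) set \<Rightarrow> player \<Rightarrow> ('a list \<Rightarrow> 'a) \<Rightarrow> bool" where
  "winning_strategy X F P p \<sigma> \<longleftrightarrow>
     (\<forall>vs. legal_play X P vs \<and> follows p \<sigma> vs \<longrightarrow>
        (set vs \<noteq> X \<and> mover (length vs) = p \<longrightarrow> legal_play X P (vs @ [\<sigma> vs])) \<and>
        (set vs = X \<longrightarrow> wins_play F p vs))"

definition has_winning_strategy ::
  "'a set \<Rightarrow> 'a set set \<Rightarrow> ('a \<times> 'a) set \<Rightarrow> player \<Rightarrow> bool" where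
  "has_winning_strategy X F P p \<longleftrightarrow> (\<exists>\<sigma>. winning_strategy X F P p \<sigma>)"

text \<open>The order \<open>P\<close> on \<open>X\<close> is the disjoint union of \<open>w\<close> nonempty chains, the \<open>i\<close>-th one being
  \<open>x i 1 > x i 2 > \<dots> > x i (len i)\<close>, for \<open>1 \<le> i \<le> w\<close>.\<close>

definition disjoint_chains ::
  "'a set \<Rightarrow> ('a \<times> 'a) set \<Rightarrow> nat \<Rightarrow> (nat \<Rightarrow> nat) \<Rightarrow> (nat \<Rightarrow> nat \<Rightarrow> 'a) \<Rightarrow> bool" where
  "disjoint_chains X P w len x \<longleftrightarrow>
     (\<forall>i\<in>{1..w}. 1 \<le> len i) \<and>
     bij_betw (\<lambda>(i, j). x i j) (SIGMA i:{1..w}. {1..len i}) X \<and>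
     (\<forall>i\<in>{1..w}. \<forall>j\<in>{1..len i}. \<forall>i'\<in>{1..w}. \<forall>j'\<in>{1..len i'}.
        (x i j, x i' j') \<in> P \<longleftrightarrow> i = i' \<and> j' \<le> j)"

definition minimal_vertex :: "'a set \<Rightarrow> ('a \<times> 'a) set \<Rightarrow> 'a \<Rightarrow> bool" where
  "minimal_vertex X P v \<longleftrightarrow> v \<in> X \<and> (\<forall>u\<in>X. (u, v) \<in> P \<longrightarrow> u = v)"

definition white_index :: "'a set \<Rightarrow> nat \<Rightarrow> bool" where
  "white_index X j \<longleftrightarrow> (even j \<longleftrightarrow> even (card X))"
  \<comment> \<open>The colour of \<open>x i j\<close> depends only on \<open>j\<close>; black means not white.\<close>


text \<open>Running time is measured on a unit-cost random access machine with a sequential read-only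
  input tape, whose only arithmetic is increment and decrement. A register thus grows by at most one
  per step beyond the constants of the program and the input words, so a linear number of steps on
  words of linear size never involves words of more than logarithmic bit length. Any
  RAM with a richer instruction set simulates this one with constant overhead.\<close>

datatype instr =
    SetConst nat nat  \<comment> \<open>\<open>SetConst a c\<close>: \<open>r\<^sub>a := c\<close>\<close>
  | Move nat nat      \<comment> \<open>\<open>Move a b\<close>: \<open>r\<^sub>a := r\<^sub>b\<close>\<close>
  | Inc nat           \<comment> \<open>\<open>Inc a\<close>: \<open>r\<^sub>a := r\<^sub>a + 1\<close>\<close>
  | Dec nat           \<comment> \<open>\<open>Dec a\<close>: \<open>r\<^sub>a := r\<^sub>a - 1\<close>, truncated at 0\<close>
  | Load nat nat      \<comment> \<open>\<open>Load a b\<close>: \<open>r\<^sub>a :=\<close> the content of the register with address \<open>r\<^sub>b\<close>\<close>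
  | Store nat nat     \<comment> \<open>\<open>Store a b\<close>: the register with address \<open>r\<^sub>a\<close> gets \<open>r\<^sub>b\<close>\<close>
  | Read nat          \<comment> \<open>\<open>Read a\<close>: \<open>r\<^sub>a :=\<close> the next input word, 0 if the input is exhausted\<close>
  | Jz nat nat        \<comment> \<open>\<open>Jz a l\<close>: jump to instruction \<open>l\<close> if \<open>r\<^sub>a = 0\<close>\<close>

record ram =
  pc :: nat
  regs :: "nat \<Rightarrow> nat"
  tape :: "nat list"

definition next_pc :: "ram \<Rightarrow> ram" where
  "next_pc s = s\<lparr>pc := pc s + 1\<rparr>"

definition set_reg :: "nat \<Rightarrow> nat \<Rightarrow> ram \<Rightarrow> ram" where
  "set_reg a c s = s\<lparr>regs := (regs s)(a := c)\<rparr>"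

fun exec_instr :: "instr \<Rightarrow> ram \<Rightarrow> ram" where
  "exec_instr (SetConst a c) s = next_pc (set_reg a c s)"
| "exec_instr (Move a b) s = next_pc (set_reg a (regs s b) s)"
| "exec_instr (Inc a) s = next_pc (set_reg a (regs s a + 1) s)"
| "exec_instr (Dec a) s = next_pc (set_reg a (regs s a - 1) s)"
| "exec_instr (Load a b) s = next_pc (set_reg a (regs s (regs s b)) s)"
| "exec_instr (Store a b) s = next_pc (set_reg (regs s a) (regs s b) s)"
| "exec_instr (Read a) s =
     next_pc (case tape s of
                [] \<Rightarrow> set_reg a 0 s
              | t # ts \<Rightarrow> set_reg a t (s\<lparr>tape := ts\<rparr>))"
| "exec_instr (Jz a l) s = (if regs s a = 0 then s\<lparr>pc := l\<rparr> else next_pc s)"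

definition halted :: "instr list \<Rightarrow> ram \<Rightarrow> bool" where
  "halted prog s \<longleftrightarrow> length prog \<le> pc s"

definition ram_step :: "instr list \<Rightarrow> ram \<Rightarrow> ram" where
  "ram_step prog s = (if halted prog s then s else exec_instr (prog ! pc s) s)"

definition ram_init :: "nat list \<Rightarrow> ram" where
  "ram_init inp = \<lparr>pc = 0, regs = (\<lambda>_. 0), tape = inp\<rparr>"

text \<open>The output is the content of register 0 when the machine halts.\<close>

definition outputs_within :: "instr list \<Rightarrow> nat list \<Rightarrow> nat \<Rightarrow> nat \<Rightarrow> bool" where
  "outputs_within prog inp t out \<longleftrightarrow>
     (let s = (ram_step prog ^^ t) (ram_init inp) in halted prog s \<and> regs s 0 = out)"

text \<open>The input word sequence of a game with board \<open>{0..<n}\<close> whose winning sets are \<open>{v}\<close> for \<open>v\<close> in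
  the list \<open>vs\<close>: the board size, the number of winning sets and their vertices, the number of
  chains, and each chain as its length followed by its vertices from top to bottom.\<close>

definition encode_game ::
  "nat \<Rightarrow> nat list \<Rightarrow> nat \<Rightarrow> (nat \<Rightarrow> nat) \<Rightarrow> (nat \<Rightarrow> nat \<Rightarrow> nat) \<Rightarrow> nat list" where
  "encode_game n vs w len x =
     [n, length vs] @ vs @ [w] @
     concat (map (\<lambda>i. len i # map (x i) [1..<Suc (len i)]) [1..<Suc w])"

end

theory Submission
  imports Defs
begin

text \<open>Maker wins by never uncovering a target vertex for Breaker, that is, by never claiming the vertex
  directly below it. If the target is white, or if there are two black targets on different chains
  and the board is odd, then whenever every target has exactly one vertex below it, an odd number of
  vertices of the other chains is left on Maker's turn, so she can pass the obligation on; at the end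
  Breaker has to uncover a target. Otherwise Breaker keeps every winning vertex covered on Maker's
  turn: on an even board he moves on a chain of odd remaining height, namely the one whose winning
  vertex Maker has just uncovered, if any; on an odd board he keeps the remaining height of the only
  chain with winning vertices odd or zero.

  The criterion is evaluated by a single pass over the chains that stops at the first white or
  minimal winning vertex, or at the second chain with a winning vertex if the board is odd.\<close>

section \<open>Plays and strategies\<close>

lemma legal_play_snoc:
  "legal_play X P (vs @ [v]) \<longleftrightarrow>
     legal_play X P vs \<and> v \<in> X \<and> v \<notin> set vs \<and> (\<forall>u\<in>X. (u, v) \<in> P \<and> u \<noteq> v \<longrightarrow> u \<in> set vs)"
  unfolding legal_play_def by (auto simp: nth_append less_Suc_eq)

lemma legal_play_Nil [simp]: "legal_play X P []"
  by (simp add: legal_play_def)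

lemma follows_snoc:
  "follows p \<sigma> (vs @ [v]) \<longleftrightarrow> follows p \<sigma> vs \<and> (mover (length vs) = p \<longrightarrow> v = \<sigma> vs)"
  unfolding follows_def by (auto simp: nth_append less_Suc_eq)

lemma claimed_by_Nil [simp]: "claimed_by p [] = {}"
  by (simp add: claimed_by_def)

lemma claimed_by_snoc:
  fixes vs :: "'a list"
  shows "claimed_by p (vs @ [v]) = claimed_by p vs \<union> (if mover (length vs) = p then {v} else {})"
proof -
  have image: "claimed_by p us = (!) us ` {k. k < length us \<and> mover k = p}" for us :: "'a list"
    by (auto simp: claimed_by_def)
  have "{k. k < length (vs @ [v]) \<and> mover k = p} =
      {k. k < length vs \<and> mover k = p} \<union> (if mover (length vs) = p then {length vs} else {})"
    by (auto simp: less_Suc_eq)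
  moreover have "(!) (vs @ [v]) ` {k. k < length vs \<and> mover k = p} =
      (!) vs ` {k. k < length vs \<and> mover k = p}"
    by (intro image_cong) (simp_all add: nth_append)
  ultimately show ?thesis by (simp add: image image_Un)
qed

lemma mover_simps [simp]:
  "mover k = Maker \<longleftrightarrow> even k" "mover k = Breaker \<longleftrightarrow> odd k"
  "mover k \<noteq> Maker \<longleftrightarrow> odd k" "mover k \<noteq> Breaker \<longleftrightarrow> even k"
  by (auto simp: mover_def)

lemma wins_play_simps:
  assumes "F = (\<lambda>v. {v}) ` S"
  shows "wins_play F Maker vs \<longleftrightarrow> claimed_by Maker vs \<inter> S \<noteq> {}"
    and "wins_play F Breaker vs \<longleftrightarrow> claimed_by Maker vs \<inter> S = {}"
  using assms by (auto simp: wins_play_def)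

text \<open>Choosing at each own turn some legal move that keeps \<open>I\<close> gives a strategy
  along whose plays \<open>I\<close> never fails. Winning thus reduces to one-move checks of an
  invariant.\<close>

lemma has_winning_strategyI:
  assumes start: "I []"
    and own: "\<And>vs. legal_play X P vs \<Longrightarrow> I vs \<Longrightarrow> set vs \<noteq> X \<Longrightarrow> mover (length vs) = p \<Longrightarrow>
      \<exists>v. legal_play X P (vs @ [v]) \<and> I (vs @ [v])"
    and other: "\<And>vs v. legal_play X P vs \<Longrightarrow> legal_play X P (vs @ [v]) \<Longrightarrow> I vs \<Longrightarrow>
      mover (length vs) \<noteq> p \<Longrightarrow> I (vs @ [v])"
    and final: "\<And>vs. legal_play X P vs \<Longrightarrow> I vs \<Longrightarrow> set vs = X \<Longrightarrow> wins_play F p vs"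
  shows "has_winning_strategy X F P p"
proof -
  define \<sigma> where "\<sigma> vs = (SOME v. legal_play X P (vs @ [v]) \<and> I (vs @ [v]))" for vs
  have \<sigma>: "legal_play X P (vs @ [\<sigma> vs]) \<and> I (vs @ [\<sigma> vs])"
    if "legal_play X P vs" "I vs" "set vs \<noteq> X" "mover (length vs) = p" for vs
    unfolding \<sigma>_def by (rule someI_ex) (rule own[OF that])
  have inv: "I vs" if "legal_play X P vs" "follows p \<sigma> vs" for vs
    using that
  proof (induction vs rule: rev_induct)
    case (snoc v vs)
    then have vs: "legal_play X P vs" "I vs" "set vs \<noteq> X"
      by (auto simp: legal_play_snoc follows_snoc)
    show ?case
    proof (cases "mover (length vs) = p")
      case True
      then show ?thesis using snoc.prems \<sigma>[OF vs True] by (simp add: follows_snoc)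
    next
      case False
      then show ?thesis using other[OF vs(1) snoc.prems(1) vs(2)] by blast
    qed
  qed (rule start)
  have "winning_strategy X F P p \<sigma>"
    unfolding winning_strategy_def using inv \<sigma> final by blast
  then show ?thesis unfolding has_winning_strategy_def by blast
qed

text \<open>The two strategies played against each other yield a complete play that both owners
  would win. The play never gets stuck because winning strategies must prescribe legal
  moves.\<close>

lemma winning_strategies_exclusive:
  assumes fin: "finite X"
    and "has_winning_strategy X F P Maker" and "has_winning_strategy X F P Breaker"
  shows False
proof -
  obtain \<sigma> \<tau> where \<sigma>: "winning_strategy X F P Maker \<sigma>" and \<tau>: "winning_strategy X F P Breaker \<tau>"
    using assms unfolding has_winning_strategy_def by blast
  have play: "\<exists>vs. legal_play X P vs \<and> follows Maker \<sigma> vs \<and> follows Breaker \<tau> vs \<and> length vs = k"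
    if "k \<le> card X" for k
    using that
  proof (induction k)
    case 0
    show ?case by (rule exI[of _ "[]"]) (simp add: follows_def)
  next
    case (Suc k)
    then obtain vs where vs: "legal_play X P vs" "follows Maker \<sigma> vs" "follows Breaker \<tau> vs"
      "length vs = k" by auto
    have "set vs \<noteq> X"
      using vs(4) Suc.prems card_length[of vs] by auto
    then have "legal_play X P (vs @ [if even k then \<sigma> vs else \<tau> vs])"
      using vs \<sigma> \<tau> unfolding winning_strategy_def by auto
    then show ?case
      using vs by (intro exI[of _ "vs @ [if even k then \<sigma> vs else \<tau> vs]"]) (simp add: follows_snoc)
  qed
  obtain vs where vs: "legal_play X P vs" "follows Maker \<sigma> vs" "follows Breaker \<tau> vs"
    "length vs = card X" using play[of "card X"] by auto
  have "set vs = X"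
    using vs fin by (intro card_subset_eq) (auto simp: legal_play_def distinct_card)
  then have "wins_play F Maker vs" "wins_play F Breaker vs"
    using vs \<sigma> \<tau> unfolding winning_strategy_def by auto
  then show False by (simp add: wins_play_def)
qed

text \<open>Serves to describe the unclaimed indices of a chain by a single number.\<close>

lemma down_closed_eq_atLeastAtMost_card:
  fixes U :: "nat set"
  assumes "finite U" and pos: "0 \<notin> U" and down: "\<And>j k. k \<in> U \<Longrightarrow> 1 \<le> j \<Longrightarrow> j \<le> k \<Longrightarrow> j \<in> U"
  shows "U = {1..card U}"
proof (cases "U = {}")
  case False
  have "U = {1..Max U}"
  proof (intro equalityI subsetI)
    fix j assume "j \<in> U"
    then show "j \<in> {1..Max U}"
      using pos Max_ge[OF assms(1), of j] by (cases j) auto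
  qed (use down[OF Max_in[OF assms(1) False]] in auto)
  moreover from this have "card U = Max U"
    by (metis card_atLeastAtMost diff_Suc_1)
  ultimately show ?thesis by simp
qed simp

section \<open>Games on disjoint chains\<close>

locale chain_board =
  fixes X :: "'a set" and P :: "('a \<times> 'a) set" and w :: nat
    and len :: "nat \<Rightarrow> nat" and x :: "nat \<Rightarrow> nat \<Rightarrow> 'a"
  assumes finite_board: "finite X"
    and chains: "disjoint_chains X P w len x"
begin

lemma len_pos: "i \<in> {1..w} \<Longrightarrow> 1 \<le> len i"
  using chains by (simp add: disjoint_chains_def)

lemma bij: "bij_betw (\<lambda>(i, j). x i j) (SIGMA i:{1..w}. {1..len i}) X"
  using chains by (simp add: disjoint_chains_def)

lemma x_in: "i \<in> {1..w} \<Longrightarrow> j \<in> {1..len i} \<Longrightarrow> x i j \<in> X"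
  using bij_betw_apply[OF bij, of "(i, j)"] by simp

lemma x_eq_iff:
  assumes "i \<in> {1..w}" "j \<in> {1..len i}" "i' \<in> {1..w}" "j' \<in> {1..len i'}"
  shows "x i j = x i' j' \<longleftrightarrow> i = i' \<and> j = j'"
  using inj_on_eq_iff[OF bij_betw_imp_inj_on[OF bij], of "(i, j)" "(i', j')"] assms by simp

lemma x_surj:
  assumes "v \<in> X"
  obtains i j where "i \<in> {1..w}" "j \<in> {1..len i}" "v = x i j"
  using bij_betw_imp_surj_on[OF bij] assms by (auto simp: image_def)

lemma P_iff:
  assumes "i \<in> {1..w}" "j \<in> {1..len i}" "i' \<in> {1..w}" "j' \<in> {1..len i'}"
  shows "(x i j, x i' j') \<in> P \<longleftrightarrow> i = i' \<and> j' \<le> j"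
  using chains assms unfolding disjoint_chains_def by blast

lemma card_board: "card X = (\<Sum>i\<in>{1..w}. len i)"
  using bij_betw_same_card[OF bij] by simp

lemma minimal_vertex_iff:
  "minimal_vertex X P v \<longleftrightarrow> (\<exists>i\<in>{1..w}. v = x i (len i))"
proof
  assume v: "minimal_vertex X P v"
  then obtain i j where ij: "i \<in> {1..w}" "j \<in> {1..len i}" "v = x i j"
    using x_surj[of v] unfolding minimal_vertex_def by blast
  have "(x i (len i), v) \<in> P"
    using ij len_pos[OF ij(1)] by (simp add: P_iff)
  then have "x i (len i) = v"
    using v x_in[OF ij(1), of "len i"] len_pos[OF ij(1)] unfolding minimal_vertex_def by auto
  then show "\<exists>i\<in>{1..w}. v = x i (len i)" using ij(1) by blast
next
  assume "\<exists>i\<in>{1..w}. v = x i (len i)"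
  then obtain i where i: "i \<in> {1..w}" "v = x i (len i)" by blast
  have L: "len i \<in> {1..len i}" using len_pos[OF i(1)] by simp
  have "u = v" if u: "u \<in> X" "(u, v) \<in> P" for u
  proof -
    obtain i' j where "i' \<in> {1..w}" "j \<in> {1..len i'}" "u = x i' j" by (rule x_surj[OF u(1)])
    then show ?thesis using P_iff[of i' j i "len i"] i L u(2) by auto
  qed
  then show "minimal_vertex X P v"
    using x_in[OF i(1) L] i(2) unfolding minimal_vertex_def by blast
qed

section \<open>Remaining heights and legal moves\<close>

definition height :: "'a list \<Rightarrow> nat \<Rightarrow> nat" where
  "height vs i = card {j \<in> {1..len i}. x i j \<notin> set vs}"

lemma height_le: "height vs i \<le> len i"
proof -
  have "card {j \<in> {1..len i}. x i j \<notin> set vs} \<le> card {1..len i}"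
    by (rule card_mono) auto
  then show ?thesis by (simp add: height_def)
qed

text \<open>Larger indices lie lower and must be claimed earlier, so the unclaimed indices form an
  initial segment. Hence \<open>height vs i\<close>, defined as a count, is also the index of the
  lowest unclaimed vertex.\<close>

lemma unclaimed_iff:
  assumes vs: "legal_play X P vs" and i: "i \<in> {1..w}" and j: "j \<in> {1..len i}"
  shows "x i j \<notin> set vs \<longleftrightarrow> j \<le> height vs i"
proof -
  let ?U = "{j \<in> {1..len i}. x i j \<notin> set vs}"
  have "?U = {1..card ?U}"
  proof (rule down_closed_eq_atLeastAtMost_card)
    fix k l assume k: "k \<in> ?U" "1 \<le> l" "l \<le> k"
    have "x i l \<notin> set vs"
    proof
      assume "x i l \<in> set vs"
      then obtain m where m: "m < length vs" "vs ! m = x i l" by (auto simp: in_set_conv_nth)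
      have "x i k \<in> X" "(x i k, x i l) \<in> P"
        using k i by (auto intro: x_in simp: P_iff)
      then have "x i k \<in> set (take m vs) \<or> x i k = x i l"
        using vs m unfolding legal_play_def by metis
      then have "x i k \<in> set vs"
        using m by (metis in_set_takeD nth_mem)
      then show False using k by blast
    qed
    then show "l \<in> ?U" using k by auto
  qed auto
  then have "j \<in> ?U \<longleftrightarrow> j \<in> {1..card ?U}" by (rule arg_cong)
  then show ?thesis using j unfolding height_def by simp
qed

lemma legal_move_iff:
  assumes vs: "legal_play X P vs" and i: "i \<in> {1..w}" and j: "j \<in> {1..len i}"
  shows "legal_play X P (vs @ [x i j]) \<longleftrightarrow> j = height vs i"
proof -
  have "(\<forall>u\<in>X. (u, x i j) \<in> P \<and> u \<noteq> x i j \<longrightarrow> u \<in> set vs) \<longleftrightarrow>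
        (\<forall>j'\<in>{1..len i}. j < j' \<longrightarrow> x i j' \<in> set vs)" (is "?L \<longleftrightarrow> ?R")
  proof
    assume ?L
    show ?R
    proof (intro ballI impI)
      fix j' assume j': "j' \<in> {1..len i}" "j < j'"
      then show "x i j' \<in> set vs"
        using \<open>?L\<close>[rule_format, OF x_in[OF i j'(1)]] i j by (simp add: P_iff x_eq_iff)
    qed
  next
    assume R: ?R
    show ?L
    proof (intro ballI impI)
      fix u assume u: "u \<in> X" "(u, x i j) \<in> P \<and> u \<noteq> x i j"
      obtain i' j' where "i' \<in> {1..w}" "j' \<in> {1..len i'}" "u = x i' j'" by (rule x_surj[OF u(1)])
      then show "u \<in> set vs" using u R P_iff[of i' j' i j] i j by (auto simp: le_less)
    qed
  qed
  also have "\<dots> \<longleftrightarrow> (\<forall>j'\<in>{1..len i}. j < j' \<longrightarrow> height vs i < j')"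
    using unclaimed_iff[OF vs i] by (intro ball_cong) (auto simp flip: not_le)
  finally have eq: "legal_play X P (vs @ [x i j]) \<longleftrightarrow>
      j \<le> height vs i \<and> (\<forall>j'\<in>{1..len i}. j < j' \<longrightarrow> height vs i < j')"
    using vs x_in[OF i j] unclaimed_iff[OF vs i j] by (simp add: legal_play_snoc)
  show ?thesis
  proof
    assume "legal_play X P (vs @ [x i j])"
    \<comment> \<open>If \<open>j < height vs i\<close>, the second condition at
      \<open>j' = height vs i\<close> would read \<open>height vs i < height vs i\<close>.\<close>
    then have "j \<le> height vs i" "\<not> j < height vs i"
      using height_le[of vs i] bspec[of "{1..len i}" _ "height vs i"] unfolding eq by fastforce+
    then show "j = height vs i" by simp
  next
    assume j_eq: "j = height vs i"
    show "legal_play X P (vs @ [x i j])" unfolding eq using j_eq by simp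
  qed
qed

lemma legal_move:
  assumes "legal_play X P vs" "i \<in> {1..w}" "0 < height vs i"
  shows "legal_play X P (vs @ [x i (height vs i)])"
  using legal_move_iff[OF assms(1,2), of "height vs i"] height_le[of vs i] assms(3) by simp

lemma legal_moveE:
  assumes "legal_play X P (vs @ [v])"
  obtains i where "i \<in> {1..w}" "0 < height vs i" "v = x i (height vs i)"
proof -
  have vs: "legal_play X P vs" "v \<in> X" using assms by (auto simp: legal_play_snoc)
  obtain i j where ij: "i \<in> {1..w}" "j \<in> {1..len i}" "v = x i j" by (rule x_surj[OF vs(2)])
  then have "j = height vs i" using legal_move_iff[OF vs(1)] assms by blast
  then show thesis using that[of i] ij by auto
qed

lemma height_snoc:
  assumes vs: "legal_play X P vs" and i: "i \<in> {1..w}" "0 < height vs i" and k: "k \<in> {1..w}"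
  shows "height (vs @ [x i (height vs i)]) k = (if k = i then height vs i - 1 else height vs k)"
proof -
  have h: "height vs i \<in> {1..len i}" using height_le[of vs i] i by simp
  have "{j \<in> {1..len k}. x k j \<notin> set (vs @ [x i (height vs i)])} =
      {j \<in> {1..len k}. x k j \<notin> set vs} - (if k = i then {height vs i} else {})"
    using x_eq_iff[OF k _ i(1) h] by auto
  moreover have "height vs i \<in> {j \<in> {1..len i}. x i j \<notin> set vs}"
    using unclaimed_iff[OF vs i(1) h] h by simp
  ultimately show ?thesis by (auto simp: height_def)
qed

lemma height_Nil [simp]: "height [] i = len i"
proof -
  have "{j \<in> {1..len i}. x i j \<notin> set []} = {1..len i}" by auto
  then show ?thesis by (simp only: height_def card_atLeastAtMost diff_Suc_1)
qed

text \<open>Since \<open>length vs\<close> tells whose turn it is, this fixes the parity of the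
  total remaining height on each turn, on which all later parity arguments rest.\<close>

lemma sum_height:
  "legal_play X P vs \<Longrightarrow> (\<Sum>i\<in>{1..w}. height vs i) + length vs = card X"
proof (induction vs rule: rev_induct)
  case Nil
  show ?case by (simp add: card_board)
next
  case (snoc v vs)
  have vs: "legal_play X P vs" using snoc.prems by (simp add: legal_play_snoc)
  obtain i where i: "i \<in> {1..w}" "0 < height vs i" "v = x i (height vs i)"
    using snoc.prems by (rule legal_moveE)
  have "(\<Sum>k\<in>{1..w}. height (vs @ [v]) k) = height vs i - 1 + (\<Sum>k\<in>{1..w}-{i}. height vs k)"
    using i by (subst sum.remove[of _ i]) (auto simp: height_snoc[OF vs i(1,2)] intro!: sum.cong)
  moreover have "(\<Sum>k\<in>{1..w}. height vs k) = height vs i + (\<Sum>k\<in>{1..w}-{i}. height vs k)"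
    using i by (subst sum.remove[of _ i]) auto
  ultimately show ?case using snoc.IH[OF vs] i(2) by simp
qed

lemma heights_zero_iff:
  assumes "legal_play X P vs"
  shows "set vs = X \<longleftrightarrow> (\<forall>i\<in>{1..w}. height vs i = 0)"
proof -
  have "set vs = X \<longleftrightarrow> length vs = card X"
    using assms finite_board card_subset_eq[of X "set vs"]
    by (auto simp: legal_play_def distinct_card)
  then show ?thesis using sum_height[OF assms] sum_eq_0_iff[of "{1..w}" "height vs"] by auto
qed

lemma legal_move_exists:
  assumes "legal_play X P vs" "set vs \<noteq> X"
  obtains k where "k \<in> {1..w}" "0 < height vs k"
  using heights_zero_iff[OF assms(1)] assms(2) by blast

lemma odd_sum_ex_odd:
  fixes h :: "nat \<Rightarrow> nat"
  assumes "odd (\<Sum>i\<in>A. h i)"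
  obtains i where "i \<in> A" "odd (h i)"
  using assms by (meson dvd_sum)

section \<open>Winning strategies for Maker\<close>

lemma Maker_wins_minimal:
  assumes F: "F = (\<lambda>v. {v}) ` S" and i: "i \<in> {1..w}" and S: "x i (len i) \<in> S"
  shows "has_winning_strategy X F P Maker"
\<comment> \<open>Maker takes the winning vertex with her first move; the disjunct
  \<open>vs = []\<close> covers only the start.\<close>
proof (rule has_winning_strategyI[where I = "\<lambda>vs. claimed_by Maker vs \<inter> S \<noteq> {} \<or> vs = []"])
  fix vs assume vs: "legal_play X P vs" "claimed_by Maker vs \<inter> S \<noteq> {} \<or> vs = []" "set vs \<noteq> X"
  obtain k where k: "k \<in> {1..w}" "0 < height vs k" using vs(1,3) by (rule legal_move_exists)
  have "legal_play X P ([] @ [x i (len i)])"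
    using legal_move[of "[]" i] i len_pos[of i] by simp
  moreover have "x i (len i) \<in> claimed_by Maker ([] @ [x i (len i)])"
    by (simp only: claimed_by_snoc) simp
  ultimately show "\<exists>v. legal_play X P (vs @ [v]) \<and>
      (claimed_by Maker (vs @ [v]) \<inter> S \<noteq> {} \<or> vs @ [v] = [])"
    using vs(2) legal_move[OF vs(1) k] S by (cases "vs = []") (blast, auto simp: claimed_by_snoc)
next
  fix vs assume "claimed_by Maker vs \<inter> S \<noteq> {} \<or> vs = []" "set vs = X"
  \<comment> \<open>A full play is not empty, because the board contains
    \<open>x i (len i)\<close>.\<close>
  then show "wins_play F Maker vs"
    using x_in[OF i, of "len i"] len_pos[OF i] wins_play_simps[OF F] by auto
qed (auto simp: claimed_by_snoc)

text \<open>A target uncovered on Maker's turn is simply taken, so the only danger is height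
  \<open>j + 1\<close>, where a move on chain \<open>i\<close> would uncover it for Breaker. The
  invariant therefore asks for a strictly covered target on Breaker's turns.\<close>

lemma Maker_wins_white:
  assumes F: "F = (\<lambda>v. {v}) ` S" and i: "i \<in> {1..w}" and j: "j \<in> {1..len i}"
    and S: "x i j \<in> S" and white: "white_index X j"
  shows "has_winning_strategy X F P Maker"
proof -
  let ?I = "\<lambda>vs. claimed_by Maker vs \<inter> S \<noteq> {} \<or>
    j \<le> height vs i \<and> (odd (length vs) \<longrightarrow> j < height vs i)"
  show ?thesis
  proof (rule has_winning_strategyI[where I = ?I])
    show "?I []" using j by simp
  next
    fix vs assume vs: "legal_play X P vs" "?I vs" "set vs \<noteq> X" "mover (length vs) = Maker"
    \<comment> \<open>A move on chain \<open>i\<close> must claim the target or leave it covered; a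
      move elsewhere requires that it is covered already.\<close>
    have "\<exists>k\<in>{1..w}. 0 < height vs k \<and> (claimed_by Maker vs \<inter> S \<noteq> {} \<or>
        (if k = i then height vs i = j \<or> j + 1 < height vs i else j < height vs i))"
    proof (cases "claimed_by Maker vs \<inter> S \<noteq> {} \<or> height vs i \<noteq> j + 1")
      case True
      obtain k where "k \<in> {1..w}" "0 < height vs k" using vs(1,3) by (rule legal_move_exists)
      then show ?thesis
        using True vs(2) i j
        by (cases "claimed_by Maker vs \<inter> S \<noteq> {}") (blast, auto intro!: bexI[of _ i])
    next
      case False
      have "(\<Sum>k\<in>{1..w}. height vs k) = height vs i + (\<Sum>k\<in>{1..w}-{i}. height vs k)"
        using i by (subst sum.remove[of _ i]) auto
      then have "even (height vs i + (\<Sum>k\<in>{1..w}-{i}. height vs k) + length vs) \<longleftrightarrow> even (card X)"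
        using sum_height[OF vs(1)] by argo
      \<comment> \<open>Here \<open>length vs\<close> is even and \<open>j\<close> has the parity of
        \<open>card X\<close>, so height \<open>j + 1\<close> on chain \<open>i\<close> leaves an
        odd total on the other chains.\<close>
      then have "odd (\<Sum>k\<in>{1..w}-{i}. height vs k)"
        using False vs(4) white by (cases "even (card X)") (simp_all add: white_index_def)
      then obtain k where "k \<in> {1..w}-{i}" "odd (height vs k)" by (rule odd_sum_ex_odd)
      then show ?thesis using False by (intro bexI[of _ k]) (auto simp: odd_pos)
    qed
    then obtain k where k: "k \<in> {1..w}" "0 < height vs k"
      and kk: "claimed_by Maker vs \<inter> S \<noteq> {} \<or>
        (if k = i then height vs i = j \<or> j + 1 < height vs i else j < height vs i)" by blast
    show "\<exists>v. legal_play X P (vs @ [v]) \<and> ?I (vs @ [v])"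
      using legal_move[OF vs(1) k] vs(4) kk S
      by (intro exI[of _ "x k (height vs k)"])
        (auto simp: claimed_by_snoc height_snoc[OF vs(1) k i] split: if_splits)
  next
    fix vs v
    assume vs: "legal_play X P vs" "legal_play X P (vs @ [v])" "?I vs" "mover (length vs) \<noteq> Maker"
    obtain k where k: "k \<in> {1..w}" "0 < height vs k" "v = x k (height vs k)"
      using vs(2) by (rule legal_moveE)
    show "?I (vs @ [v])"
      using vs(3,4) by (auto simp: k(3) claimed_by_snoc height_snoc[OF vs(1) k(1,2) i])
  next
    fix vs assume "legal_play X P vs" "?I vs" "set vs = X"
    \<comment> \<open>On a full board \<open>height vs i\<close> is 0 and hence below
      \<open>j\<close>, which excludes the second disjunct of the invariant.\<close>
    then show "wins_play F Maker vs"
      using i j heights_zero_iff[of vs] wins_play_simps[OF F] by auto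
  qed
qed

text \<open>On Maker's turn an uncovered target can be claimed, and a chain with at least two
  unclaimed vertices below its target can be lowered. The remaining case, exactly one such vertex on
  each of the two chains, is settled by parity.\<close>

lemma Maker_wins_two_black:
  assumes F: "F = (\<lambda>v. {v}) ` S" and i: "i \<in> {1..w}" "i' \<in> {1..w}" "i \<noteq> i'"
    and j: "j \<in> {1..len i}" "j' \<in> {1..len i'}"
    and S: "x i j \<in> S" "x i' j' \<in> S"
    and black: "\<not> white_index X j" "\<not> white_index X j'" and odd: "odd (card X)"
  shows "has_winning_strategy X F P Maker"
proof -
  let ?I = "\<lambda>vs. claimed_by Maker vs \<inter> S \<noteq> {} \<or>
    j \<le> height vs i \<and> j' \<le> height vs i' \<and>
    (odd (length vs) \<longrightarrow> j < height vs i \<and> j' < height vs i')"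
  let ?ok = "\<lambda>vs k. claimed_by Maker vs \<inter> S \<noteq> {} \<or> x k (height vs k) \<in> S \<or>
        j < height vs i \<and> j' < height vs i' \<and>
        (k = i \<longrightarrow> j + 1 < height vs i) \<and> (k = i' \<longrightarrow> j' + 1 < height vs i')"
  show ?thesis
  proof (rule has_winning_strategyI[where I = ?I])
    show "?I []" using j by simp
  next
    fix vs assume vs: "legal_play X P vs" "?I vs" "set vs \<noteq> X" "mover (length vs) = Maker"
    have "\<exists>k\<in>{1..w}. 0 < height vs k \<and> ?ok vs k"
    proof (cases "claimed_by Maker vs \<inter> S \<noteq> {}")
      case True
      obtain k where "k \<in> {1..w}" "0 < height vs k" using vs(1,3) by (rule legal_move_exists)
      then show ?thesis using True by blast
    next
      case unclaimed: False
      then have h: "j \<le> height vs i" "j' \<le> height vs i'" using vs(2) by auto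
      consider "height vs i = j" | "height vs i' = j'"
        | "j + 1 < height vs i" "j' < height vs i'" | "j < height vs i" "j' + 1 < height vs i'"
        | "height vs i = j + 1" "height vs i' = j' + 1"
        using h by linarith
      then show ?thesis
      proof cases
        case 1 then show ?thesis using i j S by (intro bexI[of _ i]) auto
      next
        case 2 then show ?thesis using i j S by (intro bexI[of _ i']) auto
      next
        case 3 then show ?thesis using i by (intro bexI[of _ i]) auto
      next
        case 4 then show ?thesis using i by (intro bexI[of _ i']) auto
      next
        case 5
        have "(\<Sum>k\<in>{1..w}. height vs k) =
            height vs i + (height vs i' + (\<Sum>k\<in>{1..w}-{i}-{i'}. height vs k))"
          using i by (subst sum.remove[of _ i], simp, simp, subst sum.remove[of _ i']) auto
        then have "even (height vs i + (height vs i' + (\<Sum>k\<in>{1..w}-{i}-{i'}. height vs k)) + length vs)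
            \<longleftrightarrow> even (card X)"
          using sum_height[OF vs(1)] by argo
        \<comment> \<open>Black indices are even on an odd board, so the two heights
          \<open>j + 1\<close> and \<open>j' + 1\<close> add up to an even number, while the total
          height is odd on Maker's turn.\<close>
        then have "Parity.odd (\<Sum>k\<in>{1..w}-{i}-{i'}. height vs k)"
          using 5 vs(4) black odd by (simp add: white_index_def)
        then obtain k where "k \<in> {1..w}-{i}-{i'}" "Parity.odd (height vs k)"
          by (rule odd_sum_ex_odd)
        then show ?thesis using 5 by (intro bexI[of _ k]) (auto simp: odd_pos)
      qed
    qed
    then obtain k where k: "k \<in> {1..w}" "0 < height vs k" and kk: "?ok vs k" by blast
    show "\<exists>v. legal_play X P (vs @ [v]) \<and> ?I (vs @ [v])"
      using legal_move[OF vs(1) k] vs(4) kk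
      by (intro exI[of _ "x k (height vs k)"])
        (auto simp: claimed_by_snoc height_snoc[OF vs(1) k i(1)] height_snoc[OF vs(1) k i(2)])
  next
    fix vs v
    assume vs: "legal_play X P vs" "legal_play X P (vs @ [v])" "?I vs" "mover (length vs) \<noteq> Maker"
    obtain k where k: "k \<in> {1..w}" "0 < height vs k" "v = x k (height vs k)"
      using vs(2) by (rule legal_moveE)
    show "?I (vs @ [v])"
      using vs(3,4) by (auto simp: k(3) claimed_by_snoc height_snoc[OF vs(1) k(1,2) i(1)]
          height_snoc[OF vs(1) k(1,2) i(2)])
  next
    fix vs assume "legal_play X P vs" "?I vs" "set vs = X"
    then show "wins_play F Maker vs"
      using i j heights_zero_iff[of vs] wins_play_simps[OF F] by auto
  qed
qed

section \<open>Winning strategies for Breaker\<close>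

definition exposed :: "'a set \<Rightarrow> 'a list \<Rightarrow> nat set" where
  "exposed S vs = {i \<in> {1..w}. 0 < height vs i \<and> x i (height vs i) \<in> S}"

text \<open>Maker uncovers at most one vertex per move, so the reply may assume that the winning vertices
  are exposed on at most one chain.\<close>

lemma Breaker_winsI:
  assumes F: "F = (\<lambda>v. {v}) ` S"
    and start: "exposed S [] = {}"
    and reply: "\<And>vs i. legal_play X P vs \<Longrightarrow> set vs \<noteq> X \<Longrightarrow> odd (length vs) \<Longrightarrow>
      exposed S vs \<subseteq> {i} \<Longrightarrow>
      \<exists>k\<in>{1..w}. 0 < height vs k \<and> exposed S (vs @ [x k (height vs k)]) = {}"
  shows "has_winning_strategy X F P Breaker"
proof -
  let ?I = "\<lambda>vs. claimed_by Maker vs \<inter> S = {} \<and> (\<exists>i. exposed S vs \<subseteq> {i}) \<and>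
    (even (length vs) \<longrightarrow> exposed S vs = {})"
  show ?thesis
  proof (rule has_winning_strategyI[where I = ?I])
    show "?I []" using start by simp
  next
    fix vs assume vs: "legal_play X P vs" "?I vs" "set vs \<noteq> X" "mover (length vs) = Breaker"
    then obtain k where k: "k \<in> {1..w}" "0 < height vs k"
      and "exposed S (vs @ [x k (height vs k)]) = {}"
      using reply[OF vs(1,3)] vs(2,4) unfolding mover_simps by metis
    then show "\<exists>v. legal_play X P (vs @ [v]) \<and> ?I (vs @ [v])"
      using legal_move[OF vs(1) k] vs(2,4)
      by (intro exI[of _ "x k (height vs k)"]) (simp add: claimed_by_snoc)
  next
    fix vs v
    assume vs: "legal_play X P vs" "legal_play X P (vs @ [v])" "?I vs" "mover (length vs) \<noteq> Breaker"
    obtain k where k: "k \<in> {1..w}" "0 < height vs k" "v = x k (height vs k)"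
      using vs(2) by (rule legal_moveE)
    have none: "exposed S vs = {}" using vs(3,4) by simp
    then have "v \<notin> S" using k unfolding exposed_def by blast
    moreover have "exposed S (vs @ [v]) \<subseteq> {k}"
      using none by (auto simp: exposed_def k(3) height_snoc[OF vs(1) k(1,2)] split: if_splits)
    ultimately show "?I (vs @ [v])"
      using vs(3,4) by (auto simp: claimed_by_snoc)
  next
    fix vs assume "?I vs"
    then show "wins_play F Breaker vs" using wins_play_simps[OF F] by blast
  qed
qed

lemma exposed_Nil:
  assumes "\<And>i. i \<in> {1..w} \<Longrightarrow> x i (len i) \<notin> S"
  shows "exposed S [] = {}"
  using assms by (auto simp: exposed_def)

lemma exposed_snoc:
  assumes "legal_play X P vs" "k \<in> {1..w}" "0 < height vs k"
  shows "exposed S (vs @ [x k (height vs k)]) =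
    exposed S vs - {k} \<union> (if 1 < height vs k \<and> x k (height vs k - 1) \<in> S then {k} else {})"
  using assms(2) unfolding exposed_def by (auto simp: height_snoc[OF assms] split: if_splits)

text \<open>On an even board the black indices are odd, so a move on a chain of odd height uncovers
  at most a vertex of even index, which is harmless. An exposed winning vertex itself sits at odd
  height, so answering on its chain is such a move.\<close>

lemma Breaker_wins_even:
  assumes F: "F = (\<lambda>v. {v}) ` S" and even: "even (card X)"
    and minimal: "\<And>i. i \<in> {1..w} \<Longrightarrow> x i (len i) \<notin> S"
    and white: "\<And>i j. i \<in> {1..w} \<Longrightarrow> j \<in> {1..len i} \<Longrightarrow> white_index X j \<Longrightarrow> x i j \<notin> S"
  shows "has_winning_strategy X F P Breaker"
proof (rule Breaker_winsI[OF F exposed_Nil])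
  fix vs i assume vs: "legal_play X P vs" "odd (length vs)" and i: "exposed S vs \<subseteq> {i}"
  have S_odd: "odd j" if "x k j \<in> S" "k \<in> {1..w}" "j \<in> {1..len k}" for k j
    using white[OF that(2,3)] that(1) even by (auto simp: white_index_def)
  obtain k where k: "k \<in> {1..w}" "odd (height vs k)" "exposed S vs \<subseteq> {k}"
  proof (cases "exposed S vs = {}")
    case True
    \<comment> \<open>An odd number of moves on an even board leaves an odd total, so some chain has
      odd height.\<close>
    have "odd (\<Sum>k\<in>{1..w}. height vs k)"
      using sum_height[OF vs(1)] vs(2) even by (metis even_add)
    then obtain k where "k \<in> {1..w}" "odd (height vs k)" by (rule odd_sum_ex_odd)
    then show thesis using True that by blast
  next
    case False
    then have "i \<in> exposed S vs" using i by blast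
    then have "i \<in> {1..w}" "odd (height vs i)"
      using S_odd[of i "height vs i"] height_le[of vs i] by (auto simp: exposed_def)
    then show thesis using that i by blast
  qed
  have pos: "0 < height vs k" using k(2) by (rule odd_pos)
  have "x k (height vs k - 1) \<notin> S" if "1 < height vs k"
  proof -
    have "height vs k - 1 \<in> {1..len k}" "even (height vs k - 1)"
      using that k(2) height_le[of vs k] by auto
    then show ?thesis using S_odd k(1) by blast
  qed
  then show "\<exists>k\<in>{1..w}. 0 < height vs k \<and> exposed S (vs @ [x k (height vs k)]) = {}"
    using k pos by (intro bexI[of _ k]) (auto simp: exposed_snoc[OF vs(1) k(1) pos])
qed (fact minimal)

text \<open>On an odd board the black indices are even, so the only dangerous chain \<open>c\<close>
  is harmless while its height is odd or zero. Breaker restores this by lowering \<open>c\<close>,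
  or keeps it by moving elsewhere.\<close>

lemma Breaker_wins_odd:
  assumes F: "F = (\<lambda>v. {v}) ` S" and odd: "odd (card X)"
    and minimal: "\<And>i. i \<in> {1..w} \<Longrightarrow> x i (len i) \<notin> S"
    and white: "\<And>i j. i \<in> {1..w} \<Longrightarrow> j \<in> {1..len i} \<Longrightarrow> white_index X j \<Longrightarrow> x i j \<notin> S"
    and c: "c \<in> {1..w}" "\<And>i j. i \<in> {1..w} \<Longrightarrow> j \<in> {1..len i} \<Longrightarrow> x i j \<in> S \<Longrightarrow> i = c"
  shows "has_winning_strategy X F P Breaker"
proof (rule Breaker_winsI[OF F exposed_Nil])
  fix vs assume vs: "legal_play X P vs" "set vs \<noteq> X" "Parity.odd (length vs)"
  have S_even: "even j" if "x k j \<in> S" "k \<in> {1..w}" "j \<in> {1..len k}" for k j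
    using white[OF that(2,3)] that(1) odd by (auto simp: white_index_def)
  have exp_c: "exposed S vs' \<subseteq> {c}" for vs'
  proof
    fix i assume "i \<in> exposed S vs'"
    then show "i \<in> {c}"
      using c(2)[of i "height vs' i"] height_le[of vs' i] by (auto simp: exposed_def)
  qed
  have none: "exposed S vs' = {}" if "Parity.odd (height vs' c) \<or> height vs' c = 0" for vs'
  proof (rule ccontr)
    assume "exposed S vs' \<noteq> {}"
    then have "c \<in> exposed S vs'" using exp_c by blast
    then show False
      using that S_even[of c "height vs' c"] height_le[of vs' c] c(1) by (simp add: exposed_def)
  qed
  have sum: "(\<Sum>k\<in>{1..w}. height vs k) = height vs c + (\<Sum>k\<in>{1..w}-{c}. height vs k)"
    using c(1) by (subst sum.remove[of _ c]) auto
  show "\<exists>k\<in>{1..w}. 0 < height vs k \<and> exposed S (vs @ [x k (height vs k)]) = {}"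
  proof (cases "even (height vs c) \<and> height vs c \<noteq> 0")
    case True
    then show ?thesis
      using c(1) by (intro bexI[of _ c]) (auto intro!: none simp: height_snoc[OF vs(1) c(1)])
  next
    case False
    have "\<exists>k\<in>{1..w}-{c}. 0 < height vs k"
    proof (cases "height vs c = 0")
      case True
      then show ?thesis using vs by (auto simp: heights_zero_iff)
    next
      case nonzero: False
      \<comment> \<open>On Breaker's turn the total height is even, so an odd height on
        \<open>c\<close> leaves an odd total for the other chains.\<close>
      have "Parity.odd (\<Sum>k\<in>{1..w}-{c}. height vs k)"
        using False nonzero sum_height[OF vs(1), symmetric] vs(3) odd unfolding sum by simp
      then obtain k where "k \<in> {1..w}-{c}" "Parity.odd (height vs k)"
        by (rule odd_sum_ex_odd)
      then show ?thesis by (auto intro: odd_pos)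
    qed
    then obtain k where k: "k \<in> {1..w}-{c}" "0 < height vs k" by blast
    then show ?thesis
      using False c(1) by (intro bexI[of _ k]) (auto intro!: none simp: height_snoc[OF vs(1) _ k(2)])
  qed
qed (fact minimal)

text \<open>Phrased for the set \<open>S\<close> of winning vertices, with minimal elements as chain
  bottoms \<open>x i (len i)\<close>: the form in which both the game and the program are compared
  with the criterion.\<close>

definition Maker_condition :: "'a set \<Rightarrow> bool" where
  "Maker_condition S \<longleftrightarrow>
     (\<exists>i\<in>{1..w}. x i (len i) \<in> S) \<or>
     (\<exists>i\<in>{1..w}. \<exists>j\<in>{1..len i}. white_index X j \<and> x i j \<in> S) \<or>
     (odd (card X) \<and>
        (\<exists>i\<in>{1..w}. \<exists>i'\<in>{1..w}. \<exists>j\<in>{1..len i}. \<exists>j'\<in>{1..len i'}.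
           i \<noteq> i' \<and> \<not> white_index X j \<and> \<not> white_index X j' \<and> x i j \<in> S \<and> x i' j' \<in> S))"

lemma Maker_wins:
  assumes "F = (\<lambda>v. {v}) ` S" "Maker_condition S"
  shows "has_winning_strategy X F P Maker"
  using assms(2) unfolding Maker_condition_def
  by (elim disjE bexE conjE)
    ((rule Maker_wins_minimal[OF assms(1)]; assumption),
     (rule Maker_wins_white[OF assms(1)]; assumption),
     (rule Maker_wins_two_black[OF assms(1)]; assumption))

lemma Breaker_wins:
  assumes F: "F = (\<lambda>v. {v}) ` S" and cond: "\<not> Maker_condition S"
  shows "has_winning_strategy X F P Breaker"
proof -
  note conds = cond[unfolded Maker_condition_def de_Morgan_disj]
  have minimal: "\<And>i. i \<in> {1..w} \<Longrightarrow> x i (len i) \<notin> S"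
    using conjunct1[OF conds] by blast
  have white: "\<And>i j. i \<in> {1..w} \<Longrightarrow> j \<in> {1..len i} \<Longrightarrow> white_index X j \<Longrightarrow> x i j \<notin> S"
    using conjunct1[OF conjunct2[OF conds]] by blast
  show ?thesis
  proof (cases "even (card X)")
    case True
    show ?thesis using Breaker_wins_even[OF F True minimal white] .
  next
    case odd: False
    have same: "i = i'" if "x i j \<in> S" "x i' j' \<in> S" "i \<in> {1..w}" "i' \<in> {1..w}"
      "j \<in> {1..len i}" "j' \<in> {1..len i'}" for i j i' j'
    proof (rule ccontr)
      assume "i \<noteq> i'"
      moreover have "\<not> white_index X j" "\<not> white_index X j'"
        using that white by blast+
      ultimately show False
        using that odd conjunct2[OF conjunct2[OF conds]] by blast
    qed
    obtain c where c: "c \<in> {1..w}" "\<And>i j. i \<in> {1..w} \<Longrightarrow> j \<in> {1..len i} \<Longrightarrow> x i j \<in> S \<Longrightarrow> i = c"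
    proof (cases "\<exists>i\<in>{1..w}. \<exists>j\<in>{1..len i}. x i j \<in> S")
      case True
      then show thesis using that same by metis
    next
      case False
      \<comment> \<open>Without any winning vertex every chain can serve as \<open>c\<close>; an odd
        board has at least one chain.\<close>
      have "{1..w} \<noteq> {}" using odd unfolding card_board by (metis even_zero sum.empty)
      then show thesis using that False by blast
    qed
    show ?thesis using Breaker_wins_odd[OF F odd minimal white c] .
  qed
qed

text \<open>For the forward direction, a failing criterion gives Breaker a winning strategy, which
  excludes one for Maker.\<close>

lemma Maker_wins_iff:
  assumes "F = (\<lambda>v. {v}) ` S"
  shows "has_winning_strategy X F P Maker \<longleftrightarrow> Maker_condition S"
  using Maker_wins[OF assms] Breaker_wins[OF assms] winning_strategies_exclusive[OF finite_board]
  by blast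

end


section \<open>A linear-time decision program\<close>

text \<open>Registers below 10 are scratch registers, the register with address \<open>v + 10\<close> holds the mark
  of vertex \<open>v\<close>.\<close>

definition cfg :: "nat \<Rightarrow> nat list \<Rightarrow> (nat \<Rightarrow> nat) \<Rightarrow> nat list \<Rightarrow> ram" where
  "cfg l rs mem ts = \<lparr>pc = l, regs = (\<lambda>a. if a < 10 then rs ! a else mem (a - 10)), tape = ts\<rparr>"

lemma cfg_simps [simp]:
  "pc (cfg l rs mem ts) = l"
  "tape (cfg l rs mem ts) = ts"
  "a < 10 \<Longrightarrow> regs (cfg l rs mem ts) a = rs ! a"
  "10 \<le> a \<Longrightarrow> regs (cfg l rs mem ts) a = mem (a - 10)"
  "next_pc (cfg l rs mem ts) = cfg (l + 1) rs mem ts"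
  "(cfg l rs mem ts)\<lparr>pc := l'\<rparr> = cfg l' rs mem ts"
  "(cfg l rs mem ts)\<lparr>tape := ts'\<rparr> = cfg l rs mem ts'"
  by (simp_all add: cfg_def next_pc_def)

lemma set_reg_cfg [simp]:
  "length rs = 10 \<Longrightarrow> a < 10 \<Longrightarrow> set_reg a c (cfg l rs mem ts) = cfg l (rs[a := c]) mem ts"
  "10 \<le> a \<Longrightarrow> set_reg a c (cfg l rs mem ts) = cfg l rs (mem(a - 10 := c)) ts"
  by (auto simp: cfg_def set_reg_def fun_eq_iff nth_list_update)

text \<open>Use of the registers: 0 output, 1 parity of the board size, 2 counter, 3 current vertex and its
  mark, 4 constant one, 5 whether the current vertex is white, 6 whether the current chain has a
  winning vertex, 7 whether an earlier one has, 8 number of remaining chains, 9 constant zero, so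
  that \<open>Jz 9 l\<close> is an unconditional jump. Entry points: 2 parity loop, 9 marking loop, 25 chain loop,
  30 vertex loop, 44 marked vertex, 48 change of colour, 54 end of a chain, 60 acceptance.\<close>

definition decider :: "instr list" where
  "decider =
    [Read 2, SetConst 4 1,
     Jz 2 8, Dec 2, Jz 2 7, Dec 2, Jz 9 2, SetConst 1 1,
     Read 2, Jz 2 24, Dec 2, Read 3,
     Inc 3, Inc 3, Inc 3, Inc 3, Inc 3, Inc 3, Inc 3, Inc 3, Inc 3, Inc 3,
     Store 3 4, Jz 9 9,
     Read 8, Jz 8 61, Dec 8, Read 2, SetConst 6 0, Move 5 1,
     Read 3,
     Inc 3, Inc 3, Inc 3, Inc 3, Inc 3, Inc 3, Inc 3, Inc 3, Inc 3, Inc 3,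
     Load 3 3, Dec 2, Jz 3 48, Jz 2 60, Jz 5 47, Jz 9 60, SetConst 6 1,
     Jz 5 51, SetConst 5 0, Jz 9 52, SetConst 5 1, Jz 2 54, Jz 9 30,
     Jz 6 25, Jz 1 25, Jz 7 58, Jz 9 60, SetConst 7 1, Jz 9 25,
     SetConst 0 1]"

text \<open>Splitting on Boolean register contents would multiply the cases of each symbolic execution.\<close>

lemmas [split del] = split_of_bool split_of_bool_asm

text \<open>The time is only an upper bound, so that branches of different lengths fit one
  statement.\<close>

definition runs :: "nat \<Rightarrow> ram \<Rightarrow> ram \<Rightarrow> bool" where
  "runs t s s' \<longleftrightarrow> (\<exists>k\<le>t. (ram_step decider ^^ k) s = s')"

definition outcome :: "nat \<Rightarrow> ram \<Rightarrow> nat \<Rightarrow> bool" where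
  "outcome t s out \<longleftrightarrow> (\<exists>s'. runs t s s' \<and> halted decider s' \<and> regs s' 0 = out)"

lemma runs_exact: "(ram_step decider ^^ k) s = s' \<Longrightarrow> k \<le> t \<Longrightarrow> runs t s s'"
  unfolding runs_def by blast

lemma runs_trans:
  assumes "runs t s s'" "runs t' s' s''" "t + t' \<le> u"
  shows "runs u s s''"
proof -
  obtain k k' where "k \<le> t" "k' \<le> t'" "(ram_step decider ^^ k) s = s'"
    "(ram_step decider ^^ k') s' = s''"
    using assms(1,2) unfolding runs_def by blast
  then have "(ram_step decider ^^ (k' + k)) s = s''" by (simp only: funpow_add comp_apply)
  then show ?thesis using \<open>k \<le> t\<close> \<open>k' \<le> t'\<close> assms(3) by (intro runs_exact[of "k' + k"]) auto
qed

lemma runs_outcome: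
  assumes "runs t s s'" "outcome t' s' out" "t + t' \<le> u"
  shows "outcome u s out"
  using assms runs_trans unfolding outcome_def by blast

text \<open>A halted state is a fixed point of \<open>ram_step\<close>, so halting early leaves the
  same state after exactly \<open>T\<close> steps.\<close>

lemma outcome_outputs_within:
  assumes "outcome t (ram_init inp) out" "t \<le> T"
  shows "outputs_within decider inp T out"
proof -
  obtain k s where k: "k \<le> t" "(ram_step decider ^^ k) (ram_init inp) = s"
    and s: "halted decider s" "regs s 0 = out"
    using assms(1) unfolding outcome_def runs_def by blast
  have stay: "(ram_step decider ^^ m) s = s" for m
    using s(1) by (induction m) (simp_all add: ram_step_def)
  have "(ram_step decider ^^ T) (ram_init inp) = (ram_step decider ^^ (T - k + k)) (ram_init inp)"
    using k(1) assms(2) by simp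
  also have "\<dots> = s" unfolding funpow_add comp_apply k(2) by (rule stay)
  finally show ?thesis using s unfolding outputs_within_def by simp
qed

text \<open>With a constant of its own for instruction fetch, the program can be unfolded there and stay
  folded in \<^const>\<open>ram_step\<close>.\<close>

definition fetch :: "nat \<Rightarrow> instr" where
  "fetch l = decider ! l"

lemma step_cfg:
  "l < 61 \<Longrightarrow> ram_step decider (cfg l rs mem ts) = exec_instr (fetch l) (cfg l rs mem ts)"
  by (simp add: ram_step_def halted_def decider_def fetch_def)

text \<open>Peels off the first step rather than the last, so that simplification runs the program
  forwards from a concrete state.\<close>

lemma funpow_numeral_apply: "(f ^^ numeral k) s = (f ^^ pred_numeral k) (f s)"
  by (simp add: numeral_eq_Suc funpow_swap1)

lemmas execute = funpow_numeral_apply step_cfg fetch_def[unfolded decider_def]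

lemma outcome_halt: "outcome t (cfg 61 (r # rs) mem ts) r"
  unfolding outcome_def
  by (rule exI[of _ "cfg 61 (r # rs) mem ts"])
    (simp add: runs_exact[of 0] halted_def decider_def)

lemma outcome_exact:
  assumes "(ram_step decider ^^ k) s = cfg 61 (r # rs) mem ts" "k \<le> t"
  shows "outcome t s r"
  using runs_outcome[OF runs_exact[OF assms] outcome_halt[of 0]] by simp

section \<open>Simulation of the loops\<close>

lemma parity_loop:
  "runs (3 * n + 3) (cfg 2 [0, 0, n, 0, 1, 0, 0, 0, 0, 0] mem ts)
     (cfg 8 [0, of_bool (odd n), 0, 0, 1, 0, 0, 0, 0, 0] mem ts)"
proof (induction n rule: nat_less_induct)
  case (1 n)
  consider "n = 0" | "n = 1" | m where "n = Suc (Suc m)" by (metis One_nat_def not0_implies_Suc)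
  then show ?case
  proof cases
    case 1
    then show ?thesis by (intro runs_exact[of 1]) (simp_all add: execute)
  next
    case 2
    then show ?thesis by (intro runs_exact[of 4]) (simp_all add: execute)
  next
    case 3
    \<comment> \<open>A full round subtracts two in five steps, within the bound's decrease of six.
      Register 1 is set only if the counter runs out in the middle of a round.\<close>
    have "(ram_step decider ^^ 5) (cfg 2 [0, 0, n, 0, 1, 0, 0, 0, 0, 0] mem ts) =
        cfg 2 [0, 0, m, 0, 1, 0, 0, 0, 0, 0] mem ts"
      by (simp add: 3 execute)
    moreover have "runs (3 * m + 3) (cfg 2 [0, 0, m, 0, 1, 0, 0, 0, 0, 0] mem ts)
        (cfg 8 [0, of_bool (odd n), 0, 0, 1, 0, 0, 0, 0, 0] mem ts)"
      using "1.IH" 3 by simp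
    ultimately show ?thesis
      by (rule runs_trans[OF runs_exact[OF _ order_refl]]) (simp add: 3)
  qed
qed

text \<open>Each entry costs 15 steps, ten of them increments that turn the vertex into the address
  of its mark. The final \<open>r'\<close> is left open because register 3 keeps the last
  address.\<close>

lemma mark_loop:
  "\<exists>r'. runs (15 * length vs + 1) (cfg 9 [0, p, length vs, r, 1, 0, 0, 0, 0, 0] mem (vs @ ts))
     (cfg 24 [0, p, 0, r', 1, 0, 0, 0, 0, 0] (\<lambda>v. if v \<in> set vs then 1 else mem v) ts)"
proof (induction vs arbitrary: r mem)
  case Nil
  show ?case by (intro exI[of _ r] runs_exact[of 1]) (simp_all add: execute)
next
  case (Cons v vs)
  have "(ram_step decider ^^ 15) (cfg 9 [0, p, length (v # vs), r, 1, 0, 0, 0, 0, 0] mem ((v # vs) @ ts)) =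
      cfg 9 [0, p, length vs, v + 10, 1, 0, 0, 0, 0, 0] (mem(v := 1)) (vs @ ts)"
    by (simp add: execute, simp add: numeral_eq_Suc)
  note step = runs_exact[OF this order_refl]
  have mem: "(\<lambda>u. if u \<in> set vs then 1 else (mem(v := 1)) u) =
      (\<lambda>u. if u \<in> set (v # vs) then 1 else mem u)" by auto
  obtain r' where "runs (15 * length vs + 1)
      (cfg 9 [0, p, length vs, v + 10, 1, 0, 0, 0, 0, 0] (mem(v := 1)) (vs @ ts))
      (cfg 24 [0, p, 0, r', 1, 0, 0, 0, 0, 0] (\<lambda>u. if u \<in> set (v # vs) then 1 else mem u) ts)"
    using Cons.IH[of "v + 10" "mem(v := 1)"] unfolding mem by blast
  from runs_trans[OF step this, of "15 * length (v # vs) + 1"] show ?case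
    by (intro exI[of _ r']) simp
qed

text \<open>A white or minimal winning vertex decides the game at once. The list runs from top to bottom, and
  \<open>q\<close> tells whether its first vertex is white.\<close>

fun chain_hit :: "'a set \<Rightarrow> bool \<Rightarrow> 'a list \<Rightarrow> bool" where
  "chain_hit S q [] \<longleftrightarrow> False"
| "chain_hit S q (y # ys) \<longleftrightarrow> y \<in> S \<and> (q \<or> ys = []) \<or> chain_hit S (\<not> q) ys"

text \<open>Colours alternate along a chain, so position \<open>j\<close>, counted from 0, has the
  colour of the first vertex exactly when \<open>j\<close> is even.\<close>

lemma chain_hit_iff:
  "ys \<noteq> [] \<Longrightarrow> chain_hit S q ys \<longleftrightarrow>
     last ys \<in> S \<or> (\<exists>j<length ys. ys ! j \<in> S \<and> (even j \<longleftrightarrow> q))"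
proof (induction ys arbitrary: q)
  case (Cons y ys)
  show ?case
  proof (cases "ys = []")
    case False
    have "(\<exists>j<length (y # ys). (y # ys) ! j \<in> S \<and> (even j \<longleftrightarrow> q)) \<longleftrightarrow>
        y \<in> S \<and> q \<or> (\<exists>j<length ys. ys ! j \<in> S \<and> (even j \<longleftrightarrow> \<not> q))"
      by (simp add: Ex_less_Suc2) blast
    then show ?thesis using False Cons.IH[OF False, of "\<not> q"] by auto
  qed auto
qed simp

abbreviation marks :: "nat set \<Rightarrow> nat \<Rightarrow> nat" where
  "marks S \<equiv> (\<lambda>v. of_bool (v \<in> S))"

text \<open>The counter drops before the branch, so a zero counter at 44 or 52 means that the vertex
  just read is the bottom of its chain.\<close>

lemma read_vertex:
  "(ram_step decider ^^ 14) (cfg 30 [0, p, Suc m, r, 1, q, b, s, k, 0] (marks S) (y # ts)) =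
     cfg (if y \<in> S then 44 else 48) [0, p, m, of_bool (y \<in> S), 1, q, b, s, k, 0] (marks S) ts"
  by (simp add: execute)

text \<open>A vertex that decides nothing costs 14 steps for reading, at most 3 for recording that
  it wins, at most 3 for changing the colour and at most 2 for the loop test, within the 24
  allotted.\<close>

lemma chain_loop:
  assumes "ys \<noteq> []"
  shows "if chain_hit S q ys
    then outcome (24 * length ys) (cfg 30 [0, p, length ys, r, 1, of_bool q, of_bool b, s, k, 0]
      (marks S) (ys @ ts)) 1
    else \<exists>r' q'. runs (24 * length ys) (cfg 30 [0, p, length ys, r, 1, of_bool q, of_bool b, s, k, 0]
      (marks S) (ys @ ts))
      (cfg 54 [0, p, 0, r', 1, q', of_bool (b \<or> set ys \<inter> S \<noteq> {}), s, k, 0] (marks S) ts)"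
  using assms
proof (induction ys arbitrary: q r b)
  case (Cons y ys)
  let ?s0 = "cfg 30 [0, p, length (y # ys), r, 1, of_bool q, of_bool b, s, k, 0] (marks S) ((y # ys) @ ts)"
  have read: "runs 14 ?s0 (cfg (if y \<in> S then 44 else 48)
      [0, p, length ys, of_bool (y \<in> S), 1, of_bool q, of_bool b, s, k, 0] (marks S) (ys @ ts))"
    unfolding length_Cons append_Cons by (rule runs_exact[OF read_vertex order_refl])
  show ?case
  proof (cases "y \<in> S \<and> (q \<or> ys = [])")
    case True
    \<comment> \<open>A zero counter reveals a bottom vertex, otherwise a nonzero register 5 a white
      one; both tests lead to acceptance.\<close>
    have "outcome 4 (cfg 44 [0, p, length ys, 1, 1, of_bool q, of_bool b, s, k, 0] (marks S) (ys @ ts)) 1"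
    proof (cases ys)
      case Nil
      then show ?thesis by (intro outcome_exact[of 2]) (simp_all add: execute)
    next
      case (Cons y' ys')
      then show ?thesis using True by (intro outcome_exact[of 4]) (simp_all add: execute)
    qed
    moreover have "runs 14 ?s0 (cfg 44
        [0, p, length ys, 1, 1, of_bool q, of_bool b, s, k, 0] (marks S) (ys @ ts))"
      using read True by simp
    ultimately have "outcome (24 * length (y # ys)) ?s0 1"
      using runs_outcome[where t = 14 and t' = 4] by simp
    then show ?thesis using True by simp
  next
    case False
    let ?b = "b \<or> y \<in> S"
    let ?r = "of_bool (y \<in> S)"
    let ?s2 = "cfg 52 [0, p, length ys, ?r, 1, of_bool (\<not> q), of_bool ?b, s, k, 0] (marks S) (ys @ ts)"
    \<comment> \<open>A winning vertex that does not decide the game is black and not the bottom, so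
      it only sets register 6.\<close>
    have "runs 3 (cfg (if y \<in> S then 44 else 48)
        [0, p, length ys, ?r, 1, of_bool q, of_bool b, s, k, 0] (marks S) (ys @ ts))
        (cfg 48 [0, p, length ys, ?r, 1, of_bool q, of_bool ?b, s, k, 0] (marks S) (ys @ ts))"
    proof (cases "y \<in> S")
      case True
      then obtain y' ys' where "ys = y' # ys'" "\<not> q" using False by (cases ys) auto
      then show ?thesis using True by (intro runs_exact[of 3]) (simp_all add: execute)
    next
      case False
      then show ?thesis by (intro runs_exact[of 0]) simp_all
    qed
    moreover have "runs 3 (cfg 48 [0, p, length ys, ?r, 1, of_bool q, of_bool ?b, s, k, 0] (marks S) (ys @ ts)) ?s2"
    proof (cases q)
      case True
      then show ?thesis by (intro runs_exact[of 3]) (simp_all add: execute)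
    next
      case False
      then show ?thesis by (intro runs_exact[of 2]) (simp_all add: execute)
    qed
    ultimately have to_s2: "runs 20 ?s0 ?s2"
      by (rule runs_trans[OF read runs_trans[OF _ _ order_refl]]) simp
    show ?thesis
    proof (cases ys)
      case Nil
      have "runs 1 ?s2 (cfg 54 [0, p, 0, ?r, 1, of_bool (\<not> q), of_bool ?b, s, k, 0] (marks S) ts)"
        using Nil by (intro runs_exact[of 1]) (simp_all add: execute)
      then have "runs 24 ?s0 (cfg 54 [0, p, 0, ?r, 1, of_bool (\<not> q), of_bool ?b, s, k, 0] (marks S) ts)"
        by (rule runs_trans[OF to_s2]) simp
      moreover have "(b \<or> set (y # ys) \<inter> S \<noteq> {}) \<longleftrightarrow> ?b" using Nil by auto
      moreover have "\<not> chain_hit S q (y # ys)" using False Nil by simp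
      ultimately show ?thesis using Nil by (simp del: chain_hit.simps) blast
    next
      case (Cons y' ys')
      let ?s3 = "cfg 30 [0, p, length ys, ?r, 1, of_bool (\<not> q), of_bool ?b, s, k, 0] (marks S) (ys @ ts)"
      have "runs 2 ?s2 ?s3"
        using Cons by (intro runs_exact[of 2]) (simp_all add: execute)
      then have to_s3: "runs 22 ?s0 ?s3"
        by (rule runs_trans[OF to_s2]) simp
      have hit: "chain_hit S q (y # ys) \<longleftrightarrow> chain_hit S (\<not> q) ys" using False by auto
      have b: "(b \<or> set (y # ys) \<inter> S \<noteq> {}) \<longleftrightarrow> (?b \<or> set ys \<inter> S \<noteq> {})" by auto
      have "ys \<noteq> []" using Cons by simp
      note IH = Cons.IH[OF this, of "\<not> q" ?r ?b]
      show ?thesis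
      proof (cases "chain_hit S (\<not> q) ys")
        case True
        then show ?thesis
          using runs_outcome[OF to_s3, of "24 * length ys" 1 "24 * length (y # ys)"] IH hit by simp
      next
        case False
        then obtain r' q' where "runs (24 * length ys) ?s3
            (cfg 54 [0, p, 0, r', 1, q', of_bool (?b \<or> set ys \<inter> S \<noteq> {}), s, k, 0] (marks S) ts)"
          using IH by auto
        then have "runs (24 * length (y # ys)) ?s0
            (cfg 54 [0, p, 0, r', 1, q', of_bool (b \<or> set (y # ys) \<inter> S \<noteq> {}), s, k, 0] (marks S) ts)"
          unfolding b by (rule runs_trans[OF to_s3]) simp
        then show ?thesis using False hit by (simp del: chain_hit.simps) blast
      qed
    qed
  qed
qed simp

text \<open>Here \<open>p\<close> tells whether the board is odd and \<open>s\<close> whether an earlier chain of an odd board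
  contains a winning vertex.\<close>

fun accepts :: "'a set \<Rightarrow> bool \<Rightarrow> bool \<Rightarrow> 'a list list \<Rightarrow> bool" where
  "accepts S p s [] \<longleftrightarrow> False"
| "accepts S p s (c # cs) \<longleftrightarrow>
     chain_hit S p c \<or> p \<and> set c \<inter> S \<noteq> {} \<and> s \<or> accepts S p (s \<or> p \<and> set c \<inter> S \<noteq> {}) cs"

text \<open>The flag \<open>s\<close> stands for a winning chain already passed, so the two chains
  sought are either \<open>s\<close> and one in the list, or two list positions
  \<open>a < b\<close>.\<close>

lemma accepts_iff:
  "accepts S p s cs \<longleftrightarrow>
     (\<exists>c\<in>set cs. chain_hit S p c) \<or>
     p \<and> (s \<and> (\<exists>b<length cs. set (cs ! b) \<inter> S \<noteq> {}) \<or>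
          (\<exists>b<length cs. \<exists>a<b. set (cs ! a) \<inter> S \<noteq> {} \<and> set (cs ! b) \<inter> S \<noteq> {}))"
proof (induction cs arbitrary: s)
  case (Cons c cs)
  show ?case
    unfolding accepts.simps Cons.IH length_Cons Ex_less_Suc2 nth_Cons_0 nth_Cons_Suc list.set(2)
    by (cases p; cases s; simp; blast)
qed simp

text \<open>Beyond its vertices a chain costs 5 steps at its start and at most 5 at its end, within
  the 12 allotted. The registers left arbitrary are those that a new chain overwrites.\<close>

lemma accept_loop:
  assumes "\<forall>c\<in>set cs. c \<noteq> []"
  shows "outcome (24 * length (concat cs) + 12 * length cs + 1)
    (cfg 25 [0, of_bool p, r2, r3, 1, r5, r6, of_bool s, length cs, 0] (marks S)
      (concat (map (\<lambda>c. length c # c) cs))) (of_bool (accepts S p s cs))"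
  using assms
proof (induction cs arbitrary: r2 r3 r5 r6 s)
  case Nil
  show ?case by (intro outcome_exact[of 1]) (simp_all add: execute)
next
  case (Cons c cs)
  let ?ts = "concat (map (\<lambda>c. length c # c) cs)"
  let ?s0 = "cfg 25 [0, of_bool p, r2, r3, 1, r5, r6, of_bool s, length (c # cs), 0] (marks S)
      (concat (map (\<lambda>c. length c # c) (c # cs)))"
  let ?s1 = "cfg 30 [0, of_bool p, length c, r3, 1, of_bool p, of_bool False, of_bool s, length cs, 0]
      (marks S) (c @ ?ts)"
  let ?t = "24 * length (concat (c # cs)) + 12 * length (c # cs) + 1"
  have to_s1: "runs 5 ?s0 ?s1"
    by (intro runs_exact[of 5]) (simp_all add: execute)
  have "c \<noteq> []" using Cons.prems by simp
  note loop = chain_loop[OF this, of S p "of_bool p" r3 False "of_bool s" "length cs" ?ts]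
  show ?case
  proof (cases "chain_hit S p c")
    case True
    then have "outcome (24 * length c) ?s1 1" using loop by simp
    then have "outcome ?t ?s0 1" by (rule runs_outcome[OF to_s1]) simp
    then show ?thesis using True by simp
  next
    case False
    let ?b = "set c \<inter> S \<noteq> {}"
    from False obtain r' q' where "runs (24 * length c) ?s1
        (cfg 54 [0, of_bool p, 0, r', 1, q', of_bool ?b, of_bool s, length cs, 0] (marks S) ?ts)"
      using loop by auto
    then have to_s2: "runs (24 * length c + 5) ?s0
        (cfg 54 [0, of_bool p, 0, r', 1, q', of_bool ?b, of_bool s, length cs, 0] (marks S) ?ts)"
      (is "runs _ _ ?s2")
      by (rule runs_trans[OF to_s1]) simp
    show ?thesis
    proof (cases "p \<and> ?b \<and> s")
      case True
      then have "outcome 5 ?s2 1" by (intro outcome_exact[of 5]) (simp_all add: execute)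
      then have "outcome ?t ?s0 1" by (rule runs_outcome[OF to_s2]) simp
      then show ?thesis using True by simp
    next
      case no_win: False
      let ?seen = "s \<or> p \<and> ?b"
      have "runs 5 ?s2
          (cfg 25 [0, of_bool p, 0, r', 1, q', of_bool ?b, of_bool ?seen, length cs, 0] (marks S) ?ts)"
        (is "runs _ _ ?s3")
      proof -
        consider "\<not> ?b" | "?b" "\<not> p" | "?b" "p" "\<not> s" using no_win by blast
        then show ?thesis
        proof cases
          case 1 then show ?thesis by (intro runs_exact[of 1]) (simp_all add: execute)
        next
          case 2 then show ?thesis by (intro runs_exact[of 2]) (simp_all add: execute)
        next
          case 3 then show ?thesis by (intro runs_exact[of 5]) (simp_all add: execute)
        qed
      qed
      then have to_s3: "runs (24 * length c + 10) ?s0 ?s3" by (rule runs_trans[OF to_s2]) simp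
      have "outcome (24 * length (concat cs) + 12 * length cs + 1) ?s3 (of_bool (accepts S p ?seen cs))"
        using Cons.prems by (intro Cons.IH) simp
      then have "outcome ?t ?s0 (of_bool (accepts S p ?seen cs))"
        by (rule runs_outcome[OF to_s3]) simp
      moreover have "accepts S p s (c # cs) \<longleftrightarrow> accepts S p ?seen cs"
        using False no_win by auto
      ultimately show ?thesis by simp
    qed
  qed
qed

lemma decider_correct:
  assumes "\<forall>c\<in>set cs. c \<noteq> []" and n: "n = length (concat cs)"
    and inp: "inp = [n, length vs] @ vs @ [length cs] @ concat (map (\<lambda>c. length c # c) cs)"
  shows "outputs_within decider inp (30 * length inp) (of_bool (accepts (set vs) (odd n) False cs))"
proof -
  let ?ts = "concat (map (\<lambda>c. length c # c) cs)"
  let ?p = "of_bool (odd n)"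
  have init: "ram_init inp = cfg 0 [0, 0, 0, 0, 0, 0, 0, 0, 0, 0] (\<lambda>_. 0) inp"
    by (auto simp: ram_init_def cfg_def fun_eq_iff less_Suc_eq numeral_eq_Suc)
  have "runs 2 (ram_init inp)
      (cfg 2 [0, 0, n, 0, 1, 0, 0, 0, 0, 0] (\<lambda>_. 0) (length vs # vs @ length cs # ?ts))"
    unfolding init
    by (intro runs_exact[of 2]) (simp_all add: inp execute, simp_all add: numeral_2_eq_2)
  from runs_trans[OF this parity_loop order_refl]
  have "runs (2 + (3 * n + 3)) (ram_init inp)
      (cfg 8 [0, ?p, 0, 0, 1, 0, 0, 0, 0, 0] (\<lambda>_. 0) (length vs # vs @ length cs # ?ts))" .
  moreover have "runs 1 (cfg 8 [0, ?p, 0, 0, 1, 0, 0, 0, 0, 0] (\<lambda>_. 0) (length vs # vs @ length cs # ?ts))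
      (cfg 9 [0, ?p, length vs, 0, 1, 0, 0, 0, 0, 0] (\<lambda>_. 0) (vs @ length cs # ?ts))"
    by (intro runs_exact[of 1]) (simp_all add: execute)
  ultimately have start: "runs (3 * n + 6) (ram_init inp)
      (cfg 9 [0, ?p, length vs, 0, 1, 0, 0, 0, 0, 0] (\<lambda>_. 0) (vs @ length cs # ?ts))"
    by (rule runs_trans) simp
  have mem: "(\<lambda>v. if v \<in> set vs then 1 else 0) = marks (set vs)" by auto
  obtain r where "runs (15 * length vs + 1)
      (cfg 9 [0, ?p, length vs, 0, 1, 0, 0, 0, 0, 0] (\<lambda>_. 0) (vs @ length cs # ?ts))
      (cfg 24 [0, ?p, 0, r, 1, 0, 0, 0, 0, 0] (marks (set vs)) (length cs # ?ts))"
    using mark_loop[of vs ?p 0 "\<lambda>_. 0" "length cs # ?ts"] unfolding mem by blast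
  then have "runs (3 * n + 15 * length vs + 7) (ram_init inp)
      (cfg 24 [0, ?p, 0, r, 1, 0, 0, 0, 0, 0] (marks (set vs)) (length cs # ?ts))"
    by (rule runs_trans[OF start]) simp
  moreover have "runs 1 (cfg 24 [0, ?p, 0, r, 1, 0, 0, 0, 0, 0] (marks (set vs)) (length cs # ?ts))
      (cfg 25 [0, ?p, 0, r, 1, 0, 0, of_bool False, length cs, 0] (marks (set vs)) ?ts)"
    by (intro runs_exact[of 1]) (simp_all add: execute)
  ultimately have "runs (3 * n + 15 * length vs + 8) (ram_init inp)
      (cfg 25 [0, ?p, 0, r, 1, 0, 0, of_bool False, length cs, 0] (marks (set vs)) ?ts)"
    by (rule runs_trans) simp
  from runs_outcome[OF this accept_loop[OF assms(1)] order_refl]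
  have out: "outcome (3 * n + 15 * length vs + 8 + (24 * length (concat cs) + 12 * length cs + 1))
      (ram_init inp) (of_bool (accepts (set vs) (odd n) False cs))" .
  have "length ?ts = length (concat cs) + length cs"
    by (induction cs) simp_all
  then have "length inp = 3 + length vs + n + length cs" by (simp add: inp n)
  \<comment> \<open>The bound is \<open>27 * n + 15 * length vs + 12 * length cs + 9\<close>, at
    most 30 times the input length.\<close>
  then show ?thesis using n by (intro outcome_outputs_within[OF out]) simp
qed

section \<open>The winning criterion\<close>

lemma (in chain_board) accepts_iff_Maker_condition:
  "accepts S (odd (card X)) False (map (\<lambda>i. map (x i) [1..<Suc (len i)]) [1..<Suc w]) \<longleftrightarrow>
     Maker_condition S"
proof -
  let ?chain = "\<lambda>i. map (x i) [1..<Suc (len i)]"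
  let ?decisive = "\<lambda>i. x i (len i) \<in> S \<or> (\<exists>j\<in>{1..len i}. white_index X j \<and> x i j \<in> S)"
  let ?meets = "\<lambda>i. set (?chain i) \<inter> S \<noteq> {}"
  have hit: "chain_hit S (odd (card X)) (?chain i) \<longleftrightarrow> ?decisive i" if i: "i \<in> {1..w}" for i
  proof -
    have ne: "?chain i \<noteq> []" and "last (?chain i) = x i (len i)"
      using len_pos[OF i] by (auto simp: last_map)
    \<comment> \<open>List position \<open>j\<close> holds \<open>x i (Suc j)\<close>; the top
      vertex has index 1 and is therefore white exactly on an odd board.\<close>
    moreover have "(\<exists>j<length (?chain i). ?chain i ! j \<in> S \<and> (even j \<longleftrightarrow> odd (card X))) \<longleftrightarrow>
        (\<exists>j<len i. white_index X (Suc j) \<and> x i (Suc j) \<in> S)"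
      by (auto simp: white_index_def simp del: upt_Suc)
    moreover have "\<dots> \<longleftrightarrow> (\<exists>j\<in>Suc ` {..<len i}. white_index X j \<and> x i j \<in> S)"
      by auto
    moreover have "Suc ` {..<len i} = {1..len i}"
      by (simp add: image_Suc_lessThan)
    ultimately show ?thesis unfolding chain_hit_iff[OF ne] by (simp only:)
  qed
  have meets: "?meets i \<longleftrightarrow> (\<exists>j\<in>{1..len i}. x i j \<in> S)" for i
  proof -
    have eq: "set (?chain i) = x i ` {1..len i}"
      by (simp add: atLeastLessThanSuc_atLeastAtMost del: upt_Suc)
    show ?thesis unfolding eq by blast
  qed
  have nth: "map ?chain [1..<Suc w] ! a = ?chain (Suc a)" if "a < w" for a
    using that by (simp del: upt_Suc)
  have pairs: "(\<exists>b<w. \<exists>a<b. ?meets (Suc a) \<and> ?meets (Suc b)) \<longleftrightarrow>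
      (\<exists>i\<in>{1..w}. \<exists>i'\<in>{1..w}. i \<noteq> i' \<and> ?meets i \<and> ?meets i')" (is "?L \<longleftrightarrow> ?R")
  proof
    assume ?L
    then obtain a b where "b < w" "a < b" "?meets (Suc a)" "?meets (Suc b)" by blast
    then show ?R by (intro bexI[of _ "Suc a"] bexI[of _ "Suc b"]) simp_all
  next
    assume ?R
    \<comment> \<open>By symmetry the smaller chain index may come first, in the order of the
      scan.\<close>
    then obtain i i' where "i \<in> {1..w}" "i' \<in> {1..w}" "i < i'" "?meets i" "?meets i'"
      by (metis nat_neq_iff)
    then show ?L
      by (intro exI[of _ "i' - 1"] conjI exI[of _ "i - 1"]) (auto simp del: upt_Suc)
  qed
  have "accepts S (odd (card X)) False (map ?chain [1..<Suc w]) \<longleftrightarrow>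
      (\<exists>i\<in>{1..w}. ?decisive i) \<or>
      odd (card X) \<and> (\<exists>i\<in>{1..w}. \<exists>i'\<in>{1..w}. i \<noteq> i' \<and> ?meets i \<and> ?meets i')"
  proof -
    have length: "length (map ?chain [1..<Suc w]) = w" by (simp del: upt_Suc)
    have "(\<exists>c\<in>set (map ?chain [1..<Suc w]). chain_hit S (odd (card X)) c) \<longleftrightarrow>
        (\<exists>i\<in>{1..w}. ?decisive i)"
      using hit by (auto simp: atLeastLessThanSuc_atLeastAtMost simp del: upt_Suc)
    moreover have "(\<exists>b<length (map ?chain [1..<Suc w]). \<exists>a<b.
        set (map ?chain [1..<Suc w] ! a) \<inter> S \<noteq> {} \<and> set (map ?chain [1..<Suc w] ! b) \<inter> S \<noteq> {}) \<longleftrightarrow>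
        (\<exists>b<w. \<exists>a<b. ?meets (Suc a) \<and> ?meets (Suc b))"
      unfolding length
      by (intro ex_cong1 conj_cong refl) (simp_all only: nth order.strict_trans)
    ultimately show ?thesis unfolding accepts_iff pairs by simp
  qed
  \<comment> \<open>The program pairs chains with winning vertices of any colour, but a white one
    already satisfies the second alternative of the criterion, so only black pairs add
    anything.\<close>
  also have "\<dots> \<longleftrightarrow> Maker_condition S"
    unfolding Maker_condition_def meets by blast
  finally show ?thesis .
qed

text \<open>Lets the results on a vertex set \<open>S\<close> apply to an arbitrary family of
  one-element winning sets.\<close>

lemma singletons_eq_image:
  assumes "\<forall>A\<in>F. card A = 1"
  shows "F = (\<lambda>v. {v}) ` {v. {v} \<in> F}"
proof
  show "F \<subseteq> (\<lambda>v. {v}) ` {v. {v} \<in> F}"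
  proof
    fix A assume "A \<in> F"
    then obtain v where "A = {v}" using assms by (meson card_1_singletonE)
    then show "A \<in> (\<lambda>v. {v}) ` {v. {v} \<in> F}" using \<open>A \<in> F\<close> by blast
  qed
qed blast

theorem theorem7:
  shows
    "(\<forall>(X :: 'a set) F P w len x.
        poset_game X F P \<and> disjoint_chains X P w len x \<and> (\<forall>A\<in>F. card A = 1) \<longrightarrow>
        (has_winning_strategy X F P Maker \<longleftrightarrow>
           (\<exists>v. {v} \<in> F \<and> minimal_vertex X P v) \<or>
           (\<exists>i\<in>{1..w}. \<exists>j\<in>{1..len i}. white_index X j \<and> {x i j} \<in> F) \<or>
           (odd (card X) \<and>
              (\<exists>i\<in>{1..w}. \<exists>i'\<in>{1..w}. \<exists>j\<in>{1..len i}. \<exists>j'\<in>{1..len i'}.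
                 i \<noteq> i' \<and> \<not> white_index X j \<and> \<not> white_index X j' \<and>
                 {x i j} \<in> F \<and> {x i' j'} \<in> F)))) \<and>
     (\<exists>prog c. \<forall>n F P w len x vs.
        poset_game {0..<n} F P \<and> disjoint_chains {0..<n} P w len x \<and>
        (\<forall>A\<in>F. card A = 1) \<and> distinct vs \<and> F = (\<lambda>v. {v}) ` set vs \<longrightarrow>
        (let inp = encode_game n vs w len x in
           (has_winning_strategy {0..<n} F P Maker \<and>
              outputs_within prog inp (c * length inp) 1) \<or>
           (has_winning_strategy {0..<n} F P Breaker \<and>
              outputs_within prog inp (c * length inp) 0)))"
proof (intro conjI)
  show "\<forall>(X :: 'a set) F P w len x.
        poset_game X F P \<and> disjoint_chains X P w len x \<and> (\<forall>A\<in>F. card A = 1) \<longrightarrow>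
        (has_winning_strategy X F P Maker \<longleftrightarrow>
           (\<exists>v. {v} \<in> F \<and> minimal_vertex X P v) \<or>
           (\<exists>i\<in>{1..w}. \<exists>j\<in>{1..len i}. white_index X j \<and> {x i j} \<in> F) \<or>
           (odd (card X) \<and>
              (\<exists>i\<in>{1..w}. \<exists>i'\<in>{1..w}. \<exists>j\<in>{1..len i}. \<exists>j'\<in>{1..len i'}.
                 i \<noteq> i' \<and> \<not> white_index X j \<and> \<not> white_index X j' \<and>
                 {x i j} \<in> F \<and> {x i' j'} \<in> F)))"
  proof (intro allI impI, elim conjE)
    fix X :: "'a set" and F P w len x
    assume G: "poset_game X F P" "disjoint_chains X P w len x" "\<forall>A\<in>F. card A = 1"
    then interpret chain_board X P w len x
      by unfold_locales (simp_all add: poset_game_def)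
    have win: "has_winning_strategy X F P Maker \<longleftrightarrow> Maker_condition {v. {v} \<in> F}"
      by (rule Maker_wins_iff[OF singletons_eq_image[OF G(3)]])
    have minimal: "(\<exists>v. {v} \<in> F \<and> minimal_vertex X P v) \<longleftrightarrow> (\<exists>i\<in>{1..w}. {x i (len i)} \<in> F)"
      unfolding minimal_vertex_iff by blast
    show "has_winning_strategy X F P Maker \<longleftrightarrow>
           (\<exists>v. {v} \<in> F \<and> minimal_vertex X P v) \<or>
           (\<exists>i\<in>{1..w}. \<exists>j\<in>{1..len i}. white_index X j \<and> {x i j} \<in> F) \<or>
           (odd (card X) \<and>
              (\<exists>i\<in>{1..w}. \<exists>i'\<in>{1..w}. \<exists>j\<in>{1..len i}. \<exists>j'\<in>{1..len i'}.
                 i \<noteq> i' \<and> \<not> white_index X j \<and> \<not> white_index X j' \<and>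
                 {x i j} \<in> F \<and> {x i' j'} \<in> F))"
      unfolding win minimal Maker_condition_def mem_Collect_eq by (rule refl)
  qed
next
  show "\<exists>prog c. \<forall>n F P w len x vs.
        poset_game {0..<n} F P \<and> disjoint_chains {0..<n} P w len x \<and>
        (\<forall>A\<in>F. card A = 1) \<and> distinct vs \<and> F = (\<lambda>v. {v}) ` set vs \<longrightarrow>
        (let inp = encode_game n vs w len x in
           (has_winning_strategy {0..<n} F P Maker \<and>
              outputs_within prog inp (c * length inp) 1) \<or>
           (has_winning_strategy {0..<n} F P Breaker \<and>
              outputs_within prog inp (c * length inp) 0))"
  proof (rule exI[of _ decider], rule exI[of _ 30], intro allI impI, elim conjE)
    fix n :: nat and F P w len x and vs :: "nat list"
    assume G: "disjoint_chains {0..<n} P w len x" and F: "F = (\<lambda>v. {v}) ` set vs"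
    let ?cs = "map (\<lambda>i. map (x i) [1..<Suc (len i)]) [1..<Suc w]"
    let ?inp = "encode_game n vs w len x"
    interpret chain_board "{0..<n}" P w len x
      using G by unfold_locales simp_all
    have "\<forall>c\<in>set ?cs. c \<noteq> []"
      using len_pos by (auto simp: less_Suc_eq_le Suc_le_eq simp del: upt_Suc)
    \<comment> \<open>The chains partition the board, so their lengths add up to its size.\<close>
    moreover have "n = length (concat ?cs)"
    proof -
      have "length (concat ?cs) = sum_list (map len [1..<Suc w])"
        by (simp add: length_concat comp_def del: upt_Suc)
      also have "\<dots> = (\<Sum>i\<in>{1..w}. len i)"
        by (simp add: interv_sum_list_conv_sum_set_nat atLeastLessThanSuc_atLeastAtMost del: upt_Suc)
      finally show ?thesis using card_board by simp
    qed
    moreover have "?inp = [n, length vs] @ vs @ [length ?cs] @ concat (map (\<lambda>c. length c # c) ?cs)"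
      by (simp add: encode_game_def comp_def del: upt_Suc)
    ultimately have out: "outputs_within decider ?inp (30 * length ?inp)
        (of_bool (accepts (set vs) (odd n) False ?cs))"
      by (rule decider_correct)
    have acc: "accepts (set vs) (odd n) False ?cs \<longleftrightarrow> Maker_condition (set vs)"
      using accepts_iff_Maker_condition[of "set vs"] by simp
    show "let inp = ?inp in
        has_winning_strategy {0..<n} F P Maker \<and> outputs_within decider inp (30 * length inp) 1 \<or>
        has_winning_strategy {0..<n} F P Breaker \<and> outputs_within decider inp (30 * length inp) 0"
      using out Maker_wins[OF F] Breaker_wins[OF F] unfolding acc Let_def
      by (cases "Maker_condition (set vs)") simp_all
  qed
qed

end
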